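(* Let $\mathcal{A}$ be a finite alphabet with at least two elements, let $\Sigma=\{\sigma:\mathbb{Z}\to\mathcal{A}\}$ be the shift space with metric $d_\Sigma$, let $n\ge\mathrm{card}(\mathcal{A})$, and let $\Phi=\Phi_\alpha:\Sigma\to X_n$ be the equivariant embedding of $\Sigma$ into the space of pointed trees $(X_n,d_n)$ determined by an injective map $\alpha:\mathcal{A}\to F_n^{1+}$ (as defined in the context). Then $\Phi$ is H\"older continuous, and $$0<\dim_H\Phi(\Sigma)=\underline{\dim}_B\,\Phi(\Sigma)=\overline{\dim}_B\,\Phi(\Sigma)<\infty .$$
   Context: Cayley graph. $F_n$ is the free group on $n\ge 2$ generators with identity $e$, and $F_n^{1+}$ is a (non-symmetric) set of $n$ free generators, so $h\in F_n^{1+}$ implies $h^{-1}\notin F_n^{1+}$. The Cayley graph $\mathcal{G}_n$ has vertex set $F_n$, and for every $g\in F_n$ and $h\in F_n^{1+}$ an oriented edge labelled $h$ from $g$ to $gh$. It is a tree in which every vertex has valence $2n$; every edge has length $1$. Space of pointed trees. $X_n$ is the set of all connected non-compact (i.e. infinite) subgraphs $T\subset\mathcal{G}_n$ containing the vertex $e$. Two pointed subgraphs $(T,g_1)$ and $(T',g_2)$ of $\mathcal{G}_n$ are $F_n^{1+}$-isomorphic if there is an isometry $T\to T'$ mapping $g_1$ to $g_2$ and preserving orientations and labels of edges. For $T\in X_n$ and an integer $r\ge 0$, $B_T(e,r)$ is the closed ball of radius $r$ about $e$ in $T$. For $T\neq T'$ in $X_n$ put $d_n(T,T')=e^{-r(T,T')}$,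 where $r(T,T')$ is the maximal integer $r\ge 0$ such that there is an $F_n^{1+}$-isomorphism $(B_T(e,r),e)\to(B_{T'}(e,r),e)$ (here $e^{-r}$ is the exponential); put $d_n(T,T)=0$. This is an ultrametric, called the ball metric. Shift space. $\mathbb{Z}$ acts on $\Sigma$ by $(\sigma\cdot k)(m)=\sigma(k+m)$. The metric on $\Sigma$ is $d_\Sigma(\sigma_1,\sigma_2)=2^{-k}$ for $\sigma_1\ne\sigma_2$, where $k=\max\{m\in\mathbb{Z}: \sigma_1(i)=\sigma_2(i)\text{ for all } i \in \mathbb{Z} \text{ with } |i|\le m\}$ (so $k=-1$ if $\sigma_1(0)\ne\sigma_2(0)$), and $d_\Sigma(\sigma,\sigma)=0$. The embedding. Given an injective map $\alpha:\mathcal{A}\to F_n^{1+}$ and $\sigma\in\Sigma$, define $\lambda:\mathbb{Z}\to F_n$ inductively by $\lambda(0)=e$, and for $i\ge 1$, $\lambda(i)=\lambda(i-1)\,\alpha(\sigma(i-1))$ and $\lambda(-i)=\lambda(-(i-1))\,\alpha(\sigma(-i))^{-1}$. Let $T_\sigma$ be the subgraph of $\mathcal{G}_n$ with vertex set $\lambda(\mathbb{Z})$ and with all edges of $\mathcal{G}_n$ joining $\lambda(k-1)$ to $\lambda(k)$, $k\in\mathbb{Z}$ (a bi-infinite line). Then $\Phi_\alpha(\sigma)=T_\sigma\in X_n$. H\"older continuity of $\Phi$ means that there are constants $C>0$ and $0<\gamma<1$ such that $d_n(\Phi(\sigma_1),\Phi(\sigma_2))\le C\,d_\Sigma(\sigma_1,\sigma_2)^{\gamma}$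 for all $\sigma_1,\sigma_2\in\Sigma$. $\dim_H$, $\underline{\dim}_B$ and $\overline{\dim}_B$ denote the Hausdorff, lower box and upper box dimensions with respect to $d_n$. *)

theory Defs
  imports
    "HOL-Analysis.Analysis"
    "HOL-Algebra.Group"
    "Graph_Theory.Graph_Theory"
begin

section \<open>The free group on n generators\<close>

text \<open>
  A letter \<open>(i, True)\<close> stands for the generator \<open>x\<^sub>i\<close> and \<open>(i, False)\<close> for its inverse; the
  elements of the free group are the reduced words. The product reduces at the junction while the
  letters of the left factor are put in front of the right one.
\<close>

type_synonym letter = "nat \<times> bool"
type_synonym fword = "letter list"

definition inv_letter :: "letter \<Rightarrow> letter" where
  "inv_letter x = (fst x, \<not> snd x)"

definition reduced_word :: "fword \<Rightarrow> bool" where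
  "reduced_word w \<longleftrightarrow> successively (\<lambda>x y. y \<noteq> inv_letter x) w"

fun cons_red :: "letter \<Rightarrow> fword \<Rightarrow> fword" where
  "cons_red x [] = [x]"
| "cons_red x (y # w) = (if y = inv_letter x then w else x # y # w)"

definition free_group :: "nat \<Rightarrow> fword monoid" where
  "free_group n =
     \<lparr>carrier = {w. reduced_word w \<and> fst ` set w \<subseteq> {..<n}},
      monoid.mult = (\<lambda>u v. foldr cons_red u v),
      one = []\<rparr>"

definition free_gens :: "nat \<Rightarrow> fword set" where
  "free_gens n = {[(i, True)] | i. i < n}"

lemma inv_letter_inv_letter [simp]: "inv_letter (inv_letter x) = x"
  by (simp add: inv_letter_def)

lemma fst_inv_letter [simp]: "fst (inv_letter x) = fst x"
  by (simp add: inv_letter_def)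

lemma inv_letter_neq [simp]: "inv_letter x \<noteq> x" "x \<noteq> inv_letter x"
  by (auto simp: inv_letter_def prod_eq_iff)

lemma reduced_simps [simp]:
  "reduced_word []" "reduced_word [x]"
  "reduced_word (x # y # w) \<longleftrightarrow> y \<noteq> inv_letter x \<and> reduced_word (y # w)"
  by (auto simp: reduced_word_def)

lemma reduced_ConsD: "reduced_word (x # w) \<Longrightarrow> reduced_word w"
  by (cases w) auto

lemma reduced_cons_red: "reduced_word w \<Longrightarrow> reduced_word (cons_red x w)"
  by (cases w) (auto dest: reduced_ConsD)

lemma cons_red_cancel: "reduced_word w \<Longrightarrow> cons_red x (cons_red (inv_letter x) w) = w"
  by (cases w rule: remdups_adj.cases) auto

lemma reduced_foldr: "reduced_word v \<Longrightarrow> reduced_word (foldr cons_red u v)"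
  by (induction u) (auto intro: reduced_cons_red)

lemma set_cons_red: "set (cons_red x w) \<subseteq> insert x (set w)"
  by (cases w) auto

lemma set_foldr_cons_red: "set (foldr cons_red u v) \<subseteq> set u \<union> set v"
  using set_cons_red by (induction u) fastforce+

lemma foldr_cons_red_cons_red:
  assumes "reduced_word w"
  shows "foldr cons_red (cons_red x t) w = cons_red x (foldr cons_red t w)"
proof (cases t)
  case (Cons y s)
  then show ?thesis
    using assms cons_red_cancel[of "foldr cons_red s w" x] reduced_foldr[OF assms, of s] by auto
qed auto

lemma foldr_cons_red_assoc:
  assumes "reduced_word w"
  shows "foldr cons_red (foldr cons_red u v) w = foldr cons_red u (foldr cons_red v w)"
  by (induction u) (auto simp: foldr_cons_red_cons_red assms)

lemma foldr_cons_red_inverse: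
  "foldr cons_red (rev (map inv_letter w)) w = []"
proof (induction w)
  case (Cons x w)
  then show ?case by simp
qed auto

lemma reduced_rev_inverse: "reduced_word w \<Longrightarrow> reduced_word (rev (map inv_letter w))"
  unfolding reduced_word_def
  by (auto simp: successively_rev successively_map elim!: successively_mono)

lemma group_free_group: "group (free_group n)"
proof (rule groupI)
  fix x assume x: "x \<in> carrier (free_group n)"
  then show "\<exists>y\<in>carrier (free_group n). y \<otimes>\<^bsub>free_group n\<^esub> x = \<one>\<^bsub>free_group n\<^esub>"
    by (intro bexI[of _ "rev (map inv_letter x)"])
       (auto simp: free_group_def foldr_cons_red_inverse reduced_rev_inverse)
next
  fix x y assume "x \<in> carrier (free_group n)" "y \<in> carrier (free_group n)"
  then show "x \<otimes>\<^bsub>free_group n\<^esub> y \<in> carrier (free_group n)"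
    using set_foldr_cons_red[of x y] by (simp add: free_group_def reduced_foldr) blast
qed (auto simp: free_group_def foldr_cons_red_assoc)

lemma free_gens_subset: "free_gens n \<subseteq> carrier (free_group n)"
  by (auto simp: free_gens_def free_group_def)


section \<open>The Cayley graph and the space of pointed trees\<close>

text \<open>The pair \<open>(g, h)\<close> is the edge labelled \<open>h\<close> from \<open>g\<close> to \<open>gh\<close>.\<close>

definition cayley_graph :: "nat \<Rightarrow> (fword, fword \<times> fword) pre_digraph" where
  "cayley_graph n =
     \<lparr>verts = carrier (free_group n),
      arcs = carrier (free_group n) \<times> free_gens n,
      tail = fst,
      head = (\<lambda>(g, h). g \<otimes>\<^bsub>free_group n\<^esub> h)\<rparr>"

lemma wf_digraph_cayley_graph: "wf_digraph (cayley_graph n)"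
  using free_gens_subset group.is_monoid[OF group_free_group, of n]
  by unfold_locales (auto simp: cayley_graph_def intro!: monoid.m_closed)

text \<open>
  Connectedness disregards the orientation of the edges. The edges have length 1 and the graph is
  locally finite, so a subgraph is non-compact iff it has infinitely many vertices.
\<close>

definition pointed_trees :: "nat \<Rightarrow> (fword, fword \<times> fword) pre_digraph set" where
  "pointed_trees n =
     {T. subgraph T (cayley_graph n) \<and> Digraph_Component.connected T \<and>
         infinite (verts T) \<and> \<one>\<^bsub>free_group n\<^esub> \<in> verts T}"

text \<open>The path metric on the vertices; edges may be traversed in either direction.\<close>

definition path_dist :: "('v, 'e) pre_digraph \<Rightarrow> 'v \<Rightarrow> 'v \<Rightarrow> ereal" where
  "path_dist T u v = wf_digraph.\<mu> (with_proj (mk_symmetric T)) (\<lambda>_. 1) u v"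

text \<open>
  In a subtree of the Cayley graph an edge lies in the closed ball of integer radius \<open>r\<close> around a
  vertex iff both its endpoints do.
\<close>

definition ball_graph :: "('v, 'e) pre_digraph \<Rightarrow> 'v \<Rightarrow> nat \<Rightarrow> ('v, 'e) pre_digraph" where
  "ball_graph T g r = T \<restriction> {v \<in> verts T. path_dist T g v \<le> ereal (real r)}"

definition labelled_arc ::
    "(fword, fword \<times> fword) pre_digraph \<Rightarrow> fword \<Rightarrow> fword \<Rightarrow> fword \<Rightarrow> bool" where
  "labelled_arc T u h v \<longleftrightarrow> (\<exists>a\<in>arcs T. tail T a = u \<and> head T a = v \<and> snd a = h)"

definition pointed_isomorphic ::
    "(fword, fword \<times> fword) pre_digraph \<Rightarrow> fword \<Rightarrow>
     (fword, fword \<times> fword) pre_digraph \<Rightarrow> fword \<Rightarrow> bool" where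
  "pointed_isomorphic T g1 T' g2 \<longleftrightarrow>
     (\<exists>f. bij_betw f (verts T) (verts T') \<and>
          (\<forall>u\<in>verts T. \<forall>v\<in>verts T. path_dist T' (f u) (f v) = path_dist T u v) \<and>
          f g1 = g2 \<and>
          (\<forall>u\<in>verts T. \<forall>v\<in>verts T. \<forall>h. labelled_arc T u h v \<longleftrightarrow> labelled_arc T' (f u) h (f v)))"

definition ball_radius ::
    "nat \<Rightarrow> (fword, fword \<times> fword) pre_digraph \<Rightarrow> (fword, fword \<times> fword) pre_digraph \<Rightarrow> nat" where
  "ball_radius n T T' =
     (GREATEST r. pointed_isomorphic
        (ball_graph T \<one>\<^bsub>free_group n\<^esub> r) \<one>\<^bsub>free_group n\<^esub>
        (ball_graph T' \<one>\<^bsub>free_group n\<^esub> r) \<one>\<^bsub>free_group n\<^esub>)"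

definition ball_metric ::
    "nat \<Rightarrow> (fword, fword \<times> fword) pre_digraph \<Rightarrow> (fword, fword \<times> fword) pre_digraph \<Rightarrow> real" where
  "ball_metric n T T' = (if T = T' then 0 else exp (- real (ball_radius n T T')))"


section \<open>The shift space and its embedding\<close>

definition shift_space :: "'a set \<Rightarrow> (int \<Rightarrow> 'a) set" where
  "shift_space A = {\<sigma>. range \<sigma> \<subseteq> A}"

definition shift_metric :: "(int \<Rightarrow> 'a) \<Rightarrow> (int \<Rightarrow> 'a) \<Rightarrow> real" where
  "shift_metric \<sigma>1 \<sigma>2 =
     (if \<sigma>1 = \<sigma>2 then 0
      else 2 powi (- (GREATEST m :: int. \<forall>i. \<bar>i\<bar> \<le> m \<longrightarrow> \<sigma>1 i = \<sigma>2 i)))"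

primrec line_pos :: "nat \<Rightarrow> ('a \<Rightarrow> fword) \<Rightarrow> (int \<Rightarrow> 'a) \<Rightarrow> nat \<Rightarrow> fword" where
  "line_pos n \<alpha> \<sigma> 0 = \<one>\<^bsub>free_group n\<^esub>"
| "line_pos n \<alpha> \<sigma> (Suc i) = line_pos n \<alpha> \<sigma> i \<otimes>\<^bsub>free_group n\<^esub> \<alpha> (\<sigma> (int i))"

primrec line_neg :: "nat \<Rightarrow> ('a \<Rightarrow> fword) \<Rightarrow> (int \<Rightarrow> 'a) \<Rightarrow> nat \<Rightarrow> fword" where
  "line_neg n \<alpha> \<sigma> 0 = \<one>\<^bsub>free_group n\<^esub>"
| "line_neg n \<alpha> \<sigma> (Suc i) =
     line_neg n \<alpha> \<sigma> i \<otimes>\<^bsub>free_group n\<^esub> inv\<^bsub>free_group n\<^esub> \<alpha> (\<sigma> (- int (Suc i)))"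

definition line :: "nat \<Rightarrow> ('a \<Rightarrow> fword) \<Rightarrow> (int \<Rightarrow> 'a) \<Rightarrow> int \<Rightarrow> fword" where
  "line n \<alpha> \<sigma> k =
     (if k \<ge> 0 then line_pos n \<alpha> \<sigma> (nat k) else line_neg n \<alpha> \<sigma> (nat (- k)))"

definition line_tree ::
    "nat \<Rightarrow> ('a \<Rightarrow> fword) \<Rightarrow> (int \<Rightarrow> 'a) \<Rightarrow> (fword, fword \<times> fword) pre_digraph" where
  "line_tree n \<alpha> \<sigma> =
     \<lparr>verts = range (line n \<alpha> \<sigma>),
      arcs = {a \<in> arcs (cayley_graph n).
                \<exists>k. {tail (cayley_graph n) a, head (cayley_graph n) a} =
                    {line n \<alpha> \<sigma> (k - 1), line n \<alpha> \<sigma> k}},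
      tail = tail (cayley_graph n),
      head = head (cayley_graph n)\<rparr>"

lemma line_pos_eq_map:
  assumes "\<alpha> \<in> A \<rightarrow> free_gens n" "\<sigma> \<in> shift_space A"
  shows "\<exists>w. line_pos n \<alpha> \<sigma> i = map (\<lambda>j. (j, True)) w \<and> length w = i"
proof (induction i)
  case 0
  show ?case by (simp add: free_group_def)
next
  case (Suc i)
  then obtain w where w: "line_pos n \<alpha> \<sigma> i = map (\<lambda>j. (j, True)) w" "length w = i"
    by blast
  have "\<alpha> (\<sigma> (int i)) \<in> free_gens n"
    using assms by (auto simp: shift_space_def)
  then obtain k where k: "\<alpha> (\<sigma> (int i)) = [(k, True)]"
    by (auto simp: free_gens_def)
  have "foldr cons_red (map (\<lambda>j. (j, True)) w) [(k, True)] = map (\<lambda>j. (j, True)) (w @ [k])" for w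
  proof (induction w)
    case (Cons a w)
    then show ?case by (cases w) (auto simp: inv_letter_def)
  qed simp
  then show ?case
    using w k by (intro exI[of _ "w @ [k]"]) (simp add: free_group_def)
qed

lemma line_step:
  assumes \<alpha>: "\<alpha> \<in> A \<rightarrow> free_gens n" and \<sigma>: "\<sigma> \<in> shift_space A"
  shows line_in_carrier: "line n \<alpha> \<sigma> k \<in> carrier (free_group n)"
    and line_add_1: "line n \<alpha> \<sigma> (k + 1) = line n \<alpha> \<sigma> k \<otimes>\<^bsub>free_group n\<^esub> \<alpha> (\<sigma> k)"
proof -
  interpret group "free_group n" by (rule group_free_group)
  have gen: "\<alpha> (\<sigma> k) \<in> carrier (free_group n)" for k
    using \<alpha> \<sigma> free_gens_subset[of n] by (auto simp: shift_space_def)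
  have pos: "line_pos n \<alpha> \<sigma> i \<in> carrier (free_group n)" for i
    by (induction i) (auto simp: gen)
  have neg: "line_neg n \<alpha> \<sigma> i \<in> carrier (free_group n)" for i
    by (induction i) (use gen in auto)
  show "line n \<alpha> \<sigma> k \<in> carrier (free_group n)"
    by (simp add: line_def pos neg)
  show "line n \<alpha> \<sigma> (k + 1) = line n \<alpha> \<sigma> k \<otimes>\<^bsub>free_group n\<^esub> \<alpha> (\<sigma> k)"
  proof (cases "k \<ge> 0")
    case True
    then have "nat (k + 1) = Suc (nat k)" by simp
    with True show ?thesis by (simp add: line_def)
  next
    case False
    define i where "i = nat (- (k + 1))"
    have i: "k = - int (Suc i)" using False by (simp add: i_def)
    have "line n \<alpha> \<sigma> (k + 1) = line_neg n \<alpha> \<sigma> i"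
      using i by (cases "i = 0") (auto simp: line_def)
    moreover have "line n \<alpha> \<sigma> k = line_neg n \<alpha> \<sigma> (Suc i)"
      using i by (simp add: line_def nat_add_distrib)
    ultimately show ?thesis
      using gen[of k] neg[of i] i by (simp add: m_assoc)
  qed
qed

lemma line_tree_in_pointed_trees:
  assumes \<alpha>: "\<alpha> \<in> A \<rightarrow> free_gens n" and \<sigma>: "\<sigma> \<in> shift_space A"
  shows "line_tree n \<alpha> \<sigma> \<in> pointed_trees n"
proof -
  let ?T = "line_tree n \<alpha> \<sigma>" and ?l = "line n \<alpha> \<sigma>"
  have wf: "wf_digraph ?T"
    by unfold_locales (auto simp: line_tree_def doubleton_eq_iff)
  have sub: "subgraph ?T (cayley_graph n)"
    using wf wf_digraph_cayley_graph line_in_carrier[OF assms]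
    by (auto simp: subgraph_def compatible_def line_tree_def cayley_graph_def)
  have "inj (line_pos n \<alpha> \<sigma>)"
    using line_pos_eq_map[OF assms] by (metis injI length_map)
  then have "infinite (range (line_pos n \<alpha> \<sigma>))"
    by (rule range_inj_infinite)
  moreover have "range (line_pos n \<alpha> \<sigma>) \<subseteq> range ?l"
  proof clarify
    fix i show "line_pos n \<alpha> \<sigma> i \<in> range ?l"
      by (rule range_eqI[of _ _ "int i"]) (simp add: line_def)
  qed
  ultimately have inf: "infinite (verts ?T)"
    by (auto simp: line_tree_def dest: infinite_super)
  have one: "\<one>\<^bsub>free_group n\<^esub> \<in> verts ?T"
  proof -
    have "\<one>\<^bsub>free_group n\<^esub> = ?l 0" by (simp add: line_def)
    then show ?thesis by (simp add: line_tree_def)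
  qed
  interpret S: pair_wf_digraph "mk_symmetric ?T"
    using wf by (rule wf_digraph.wellformed_mk_symmetric)
  have arc: "(?l k, ?l (k + 1)) \<in> parcs (mk_symmetric ?T)"
            "(?l (k + 1), ?l k) \<in> parcs (mk_symmetric ?T)" for k
  proof -
    have "\<alpha> (\<sigma> k) \<in> free_gens n"
      using assms by (auto simp: shift_space_def)
    then have "(?l k, \<alpha> (\<sigma> k)) \<in> arcs ?T"
      using line_in_carrier[OF assms, of k] line_add_1[OF assms, of k]
      by (auto simp: line_tree_def cayley_graph_def intro!: exI[of _ "k + 1"])
    moreover have "tail ?T (?l k, \<alpha> (\<sigma> k)) = ?l k" "head ?T (?l k, \<alpha> (\<sigma> k)) = ?l (k + 1)"
      using line_add_1[OF assms, of k] by (auto simp: line_tree_def cayley_graph_def)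
    ultimately show "(?l k, ?l (k + 1)) \<in> parcs (mk_symmetric ?T)"
        "(?l (k + 1), ?l k) \<in> parcs (mk_symmetric ?T)"
      unfolding parcs_mk_symmetric by (force intro: bexI)+
  qed
  have reach: "?l j \<rightarrow>\<^sup>*\<^bsub>mk_symmetric ?T\<^esub> ?l (j + int m) \<and> ?l (j + int m) \<rightarrow>\<^sup>*\<^bsub>mk_symmetric ?T\<^esub> ?l j"
    for j m
  proof (induction m)
    case 0
    have "?l j \<in> verts (with_proj (mk_symmetric ?T))"
      unfolding with_proj_simps pverts_mk_symmetric by (simp add: line_tree_def)
    then have "?l j \<rightarrow>\<^sup>*\<^bsub>mk_symmetric ?T\<^esub> ?l j"
      by (auto simp: reachable_def simp del: with_proj_simps intro: rtrancl_on.intros)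
    then show ?case by simp
  next
    case (Suc m)
    have eq: "j + int (Suc m) = (j + int m) + 1" by simp
    show ?case
      unfolding eq using Suc arc[of "j + int m"]
      by (auto intro: S.reachable_adj_trans S.adj_reachable_trans)
  qed
  have "?l j \<rightarrow>\<^sup>*\<^bsub>mk_symmetric ?T\<^esub> ?l k" for j k
    using reach[of j "nat (k - j)"] reach[of k "nat (j - k)"] by (cases "j \<le> k") auto
  then have "Digraph_Component.connected ?T"
    unfolding connected_def by (intro strongly_connectedI) (auto simp: line_tree_def)
  then show ?thesis
    using sub inf one by (simp add: pointed_trees_def)
qed


section \<open>Hoelder continuity and dimensions\<close>

definition hoelder_continuous_on ::
    "'x set \<Rightarrow> ('x \<Rightarrow> 'x \<Rightarrow> real) \<Rightarrow> ('y \<Rightarrow> 'y \<Rightarrow> real) \<Rightarrow> ('x \<Rightarrow> 'y) \<Rightarrow> bool" where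
  "hoelder_continuous_on S d d' f \<longleftrightarrow>
     (\<exists>C \<gamma>. C > 0 \<and> 0 < \<gamma> \<and> \<gamma> < 1 \<and>
        (\<forall>x\<in>S. \<forall>y\<in>S. d' (f x) (f y) \<le> C * d x y powr \<gamma>))"

text \<open>
  Below, \<open>M\<close> is the carrier of the ambient metric space, \<open>d\<close> its metric and \<open>S\<close> the subset
  whose dimension is taken. The supremum of \<open>set_diam\<close> is used only for bounded sets.
\<close>

definition set_diam :: "('x \<Rightarrow> 'x \<Rightarrow> real) \<Rightarrow> 'x set \<Rightarrow> real" where
  "set_diam d U = (if U = {} then 0 else SUP (x, y) \<in> U \<times> U. d x y)"

definition diam_le :: "('x \<Rightarrow> 'x \<Rightarrow> real) \<Rightarrow> real \<Rightarrow> 'x set \<Rightarrow> bool" where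
  "diam_le d \<delta> U \<longleftrightarrow> (\<forall>x\<in>U. \<forall>y\<in>U. d x y \<le> \<delta>)"

definition hausdorff_premeasure ::
    "'x set \<Rightarrow> ('x \<Rightarrow> 'x \<Rightarrow> real) \<Rightarrow> real \<Rightarrow> real \<Rightarrow> 'x set \<Rightarrow> ennreal" where
  "hausdorff_premeasure M d s \<delta> S =
     (INF U \<in> {U :: nat \<Rightarrow> 'x set. (\<forall>i. U i \<subseteq> M \<and> diam_le d \<delta> (U i)) \<and> S \<subseteq> (\<Union>i. U i)}.
        \<Sum>i. ennreal (set_diam d (U i) powr s))"

definition hausdorff_measure ::
    "'x set \<Rightarrow> ('x \<Rightarrow> 'x \<Rightarrow> real) \<Rightarrow> real \<Rightarrow> 'x set \<Rightarrow> ennreal" where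
  "hausdorff_measure M d s S = (SUP \<delta> \<in> {0<..}. hausdorff_premeasure M d s \<delta> S)"

text \<open>
  Only exponents \<open>s > 0\<close> are considered, since \<open>0 powr 0 = 0\<close> would give the wrong measure for
  \<open>s = 0\<close>; this does not affect the infimum.
\<close>

definition hausdorff_dim :: "'x set \<Rightarrow> ('x \<Rightarrow> 'x \<Rightarrow> real) \<Rightarrow> 'x set \<Rightarrow> ereal" where
  "hausdorff_dim M d S = Inf {ereal s | s. 0 < s \<and> hausdorff_measure M d s S = 0}"

text \<open>The least number of sets of diameter at most \<open>\<delta>\<close> that cover \<open>S\<close>.\<close>

definition covering_number ::
    "'x set \<Rightarrow> ('x \<Rightarrow> 'x \<Rightarrow> real) \<Rightarrow> real \<Rightarrow> 'x set \<Rightarrow> enat" where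
  "covering_number M d \<delta> S =
     (INF \<U> \<in> {\<U>. finite \<U> \<and> (\<forall>U\<in>\<U>. U \<subseteq> M \<and> diam_le d \<delta> U) \<and> S \<subseteq> \<Union>\<U>}.
        enat (card \<U>))"

definition box_ratio :: "'x set \<Rightarrow> ('x \<Rightarrow> 'x \<Rightarrow> real) \<Rightarrow> 'x set \<Rightarrow> real \<Rightarrow> ereal" where
  "box_ratio M d S \<delta> =
     (case covering_number M d \<delta> S of
        enat m \<Rightarrow> ereal (ln (real m) / (- ln \<delta>))
      | \<infinity> \<Rightarrow> \<infinity>)"

definition lower_box_dim :: "'x set \<Rightarrow> ('x \<Rightarrow> 'x \<Rightarrow> real) \<Rightarrow> 'x set \<Rightarrow> ereal" where
  "lower_box_dim M d S = Liminf (at_right 0) (box_ratio M d S)"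

definition upper_box_dim :: "'x set \<Rightarrow> ('x \<Rightarrow> 'x \<Rightarrow> real) \<Rightarrow> 'x set \<Rightarrow> ereal" where
  "upper_box_dim M d S = Limsup (at_right 0) (box_ratio M d S)"

end

theory Submission
  imports Defs "HOL-Probability.Probability"
begin

text \<open>
  The point is that the ball metric, pulled back to the shift space, is a function of the central
  word on which two sequences agree. The ball of radius \<open>r\<close> in the line of \<open>\<sigma>\<close> consists of the
  vertices \<open>\<lambda>(-r), ..., \<lambda>(r)\<close> and of the \<open>2r\<close> edges between them, whose labels are
  \<open>\<sigma>(-r), ..., \<sigma>(r - 1)\<close>. In the Cayley graph an edge is determined by its label and one endpoint,
  so an isomorphism of such balls fixing the identity is the identity map, and the balls of \<open>\<sigma>\<close> and
  \<open>\<tau>\<close> are isomorphic iff these \<open>2r\<close> letters coincide (\<open>pointed_isomorphic_balls_iff\<close>). Hence the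
  images of \<open>\<sigma>\<close> and \<open>\<tau>\<close> are at distance at most \<open>\<delta>\<close> iff the sequences agree on
  \<open>{-r..<r}\<close> with \<open>r = \<lceil>- ln \<delta>\<rceil>\<close>, read as \<open>0\<close> if negative (\<open>ball_metric_line_tree_le_iff\<close>).

  Hoelder continuity follows at once: if the sequences agree on \<open>{-k..k}\<close> with \<open>k \<ge> 0\<close>, then the
  distance in the tree space is at most \<open>exp (- k)\<close>, while the distance in the shift space is a
  power of 2 with exponent \<open>- k\<close>, for the largest such \<open>k\<close>. If already \<open>\<sigma> 0 \<noteq> \<tau> 0\<close>, the distance in
  the shift space is 2, and no distance in the tree space exceeds 1.

  For the dimensions only this description of the distances matters, and it makes the image behave
  like a regular Cantor set: at scale \<open>exp (- r)\<close> it falls into \<open>card A ^ (2 * r)\<close> cylinders, and a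
  set of that diameter meets only one of them. So the covering numbers are known exactly and
  both box dimensions equal \<open>2 * ln (card A)\<close>. Covering by cylinders shows that the Hausdorff
  measure vanishes in every larger exponent. In the exponents up to \<open>2 * ln (card A)\<close> it is at
  least 1 by the mass distribution principle for the uniform Bernoulli measure, which gives
  a cylinder of diameter at most \<open>exp (- r)\<close> the mass \<open>card A ^ (- 2 * r)\<close>
  (\<open>mass_le_diam_powr\<close>). All three dimensions are therefore \<open>2 * ln (card A)\<close>, which is
  positive because the alphabet has at least two letters.
\<close>

section \<open>Agreement on central words\<close>

text \<open>
  The window is not symmetric: the edge of the line from position \<open>i\<close> to position \<open>i + 1\<close> carries
  the letter \<open>\<sigma> i\<close>, so these are the letters read between the positions \<open>- r\<close> and \<open>r\<close>.
\<close>

definition agree :: "nat \<Rightarrow> (int \<Rightarrow> 'a) \<Rightarrow> (int \<Rightarrow> 'a) \<Rightarrow> bool" where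
  "agree r \<sigma> \<tau> \<longleftrightarrow> (\<forall>i\<in>{- int r..<int r}. \<sigma> i = \<tau> i)"

lemma agree_mono: "agree r \<sigma> \<tau> \<Longrightarrow> q \<le> r \<Longrightarrow> agree q \<sigma> \<tau>"
  by (auto simp: agree_def)

lemma agree_sym: "agree r \<sigma> \<tau> \<Longrightarrow> agree r \<tau> \<sigma>"
  by (simp add: agree_def)

lemma agree_trans: "agree r \<sigma> \<tau> \<Longrightarrow> agree r \<tau> \<upsilon> \<Longrightarrow> agree r \<sigma> \<upsilon>"
  by (simp add: agree_def)

lemma agree_all_imp_eq:
  assumes "\<And>r. agree r \<sigma> \<tau>" shows "\<sigma> = \<tau>"
proof
  fix i show "\<sigma> i = \<tau> i"
    using assms[of "nat \<bar>i\<bar> + 1"] unfolding agree_def by (rule bspec) auto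
qed

section \<open>Distances in a line of the Cayley graph\<close>

text \<open>
  This is the homomorphism from the free group to the integers that sends every generator to 1. It
  serves as a height function: every edge of the Cayley graph changes it by exactly 1, and along a
  line it recovers the position, so that a vertex common to two lines has the same position on both.
\<close>

definition exponent_sum :: "fword \<Rightarrow> int" where
  "exponent_sum w = (\<Sum>x\<leftarrow>w. if snd x then 1 else - 1)"

lemma exponent_sum_simps [simp]:
  "exponent_sum [] = 0"
  "exponent_sum (x # w) = (if snd x then 1 else - 1) + exponent_sum w"
  by (simp_all add: exponent_sum_def)

lemma exponent_sum_cons_red: "exponent_sum (cons_red x w) = exponent_sum [x] + exponent_sum w"
  by (cases w) (auto simp: inv_letter_def)

lemma exponent_sum_mult:
  "exponent_sum (u \<otimes>\<^bsub>free_group n\<^esub> v) = exponent_sum u + exponent_sum v"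
  by (induction u) (auto simp: free_group_def exponent_sum_cons_red)

lemma exponent_sum_free_gens: "h \<in> free_gens n \<Longrightarrow> exponent_sum h = 1"
  by (auto simp: free_gens_def)

lemma line_0 [simp]: "line n \<alpha> \<sigma> 0 = []"
  by (simp add: line_def free_group_def)

lemma exponent_sum_line:
  assumes "\<alpha> \<in> A \<rightarrow> free_gens n" "\<sigma> \<in> shift_space A"
  shows "exponent_sum (line n \<alpha> \<sigma> k) = k"
proof -
  have step: "exponent_sum (line n \<alpha> \<sigma> (k + 1)) = exponent_sum (line n \<alpha> \<sigma> k) + 1" for k
  proof -
    have "\<alpha> (\<sigma> k) \<in> free_gens n"
      using assms by (auto simp: shift_space_def)
    then show ?thesis
      by (simp add: line_add_1[OF assms] exponent_sum_mult exponent_sum_free_gens)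
  qed
  show ?thesis
  proof (induction k rule: int_induct[where k = 0])
    case (step2 i)
    then show ?case using step[of "i - 1"] by simp
  qed (simp_all add: step)
qed

text \<open>
  Every step of a walk changes the exponent sum by 1, whichever way the edge is traversed.
\<close>

lemma exponent_sum_le_path_dist:
  assumes T: "subgraph T (cayley_graph n)"
  shows "ereal (real_of_int \<bar>exponent_sum v - exponent_sum u\<bar>) \<le> path_dist T u v"
proof -
  have wf: "wf_digraph T" and arcs: "arcs T \<subseteq> arcs (cayley_graph n)"
    and ends: "tail T = tail (cayley_graph n)" "head T = head (cayley_graph n)"
    using T by (auto simp: subgraph_def compatible_def)
  interpret S: pair_wf_digraph "mk_symmetric T"
    using wf by (rule wf_digraph.wellformed_mk_symmetric)
  have step: "\<bar>exponent_sum y - exponent_sum x\<bar> = 1" if "(x, y) \<in> parcs (mk_symmetric T)" for x y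
    using that arcs
    by (auto simp: parcs_mk_symmetric ends cayley_graph_def exponent_sum_mult exponent_sum_free_gens)
  have walk: "\<bar>exponent_sum v - exponent_sum u\<bar> \<le> int (length p)" if "S.awalk u p v" for p
    using that
  proof (induction p arbitrary: u)
    case (Cons e p)
    then have e: "e \<in> parcs (mk_symmetric T)" "fst e = u" and p: "S.awalk (snd e) p v"
      by (auto simp: S.awalk_Cons_iff)
    have "\<bar>exponent_sum (snd e) - exponent_sum u\<bar> = 1"
      using step[of u "snd e"] e by (metis prod.collapse)
    with Cons.IH[OF p] show ?case by simp
  qed (simp add: S.awalk_Nil_iff)
  have cost: "S.awalk_cost (\<lambda>_. 1) p = real (length p)" for p
    by (induction p) auto
  have "real_of_int \<bar>exponent_sum v - exponent_sum u\<bar> \<le> real (length p)" if "S.awalk u p v" for p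
    using walk[OF that] by linarith
  then show ?thesis
    unfolding path_dist_def S.\<mu>_def by (intro INF_greatest) (simp add: cost)
qed

lemma line_tree_subgraph:
  assumes "\<alpha> \<in> A \<rightarrow> free_gens n" "\<sigma> \<in> shift_space A"
  shows "subgraph (line_tree n \<alpha> \<sigma>) (cayley_graph n)"
  using line_tree_in_pointed_trees[OF assms] by (simp add: pointed_trees_def)

lemma line_tree_arc:
  assumes "\<alpha> \<in> A \<rightarrow> free_gens n" "\<sigma> \<in> shift_space A"
  shows "(line n \<alpha> \<sigma> k, \<alpha> (\<sigma> k)) \<in> arcs (line_tree n \<alpha> \<sigma>)"
    and "tail (line_tree n \<alpha> \<sigma>) (line n \<alpha> \<sigma> k, \<alpha> (\<sigma> k)) = line n \<alpha> \<sigma> k"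
    and "head (line_tree n \<alpha> \<sigma>) (line n \<alpha> \<sigma> k, \<alpha> (\<sigma> k)) = line n \<alpha> \<sigma> (k + 1)"
proof -
  have "\<alpha> (\<sigma> k) \<in> free_gens n"
    using assms by (auto simp: shift_space_def)
  then show "(line n \<alpha> \<sigma> k, \<alpha> (\<sigma> k)) \<in> arcs (line_tree n \<alpha> \<sigma>)"
    using line_in_carrier[OF assms, of k] line_add_1[OF assms, of k]
    by (auto simp: line_tree_def cayley_graph_def intro!: exI[of _ "k + 1"])
qed (use line_add_1[OF assms, of k] in \<open>auto simp: line_tree_def cayley_graph_def\<close>)

text \<open>
  Walking along the line gives the upper bound, and the exponent sum shows that there is no shortcut.
\<close>

lemma path_dist_line_tree:
  assumes "\<alpha> \<in> A \<rightarrow> free_gens n" "\<sigma> \<in> shift_space A"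
  shows "path_dist (line_tree n \<alpha> \<sigma>) [] (line n \<alpha> \<sigma> k) = ereal (real_of_int \<bar>k\<bar>)"
proof (rule antisym)
  let ?T = "line_tree n \<alpha> \<sigma>" and ?l = "line n \<alpha> \<sigma>"
  have "wf_digraph ?T"
    using line_tree_subgraph[OF assms] by (auto simp: subgraph_def)
  then interpret S: pair_wf_digraph "mk_symmetric ?T"
    by (rule wf_digraph.wellformed_mk_symmetric)
  have verts: "?l j \<in> pverts (mk_symmetric ?T)" for j
    by (simp add: line_tree_def)
  have arc: "(?l j, ?l (j + 1)) \<in> parcs (mk_symmetric ?T)"
            "(?l (j + 1), ?l j) \<in> parcs (mk_symmetric ?T)" for j
    using line_tree_arc[OF assms, of j] unfolding parcs_mk_symmetric by (force intro: bexI)+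
  \<comment> \<open>The sign \<open>s\<close> is the direction of the walk.\<close>
  have walk: "\<exists>p. S.awalk (?l j) p (?l (j + s * int m)) \<and> length p = m" if "s = 1 \<or> s = - 1" for j s m
  proof (induction m arbitrary: j)
    case 0
    show ?case using verts by (simp add: S.awalk_Nil_iff)
  next
    case (Suc m)
    obtain p where "S.awalk (?l (j + s)) p (?l (j + s + s * int m))" "length p = m"
      using Suc by blast
    moreover have "(?l j, ?l (j + s)) \<in> parcs (mk_symmetric ?T)"
      using that arc[of j] arc[of "j - 1"] by auto
    ultimately show ?case
      by (intro exI[of _ "(?l j, ?l (j + s)) # p"]) (simp add: S.awalk_Cons_iff algebra_simps)
  qed
  obtain p where p: "S.awalk [] p (?l k)" "length p = nat \<bar>k\<bar>"
    using walk[of "if k \<ge> 0 then 1 else - 1" 0 "nat \<bar>k\<bar>"] by (cases "k \<ge> 0") auto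
  have "S.awalk_cost (\<lambda>_. 1) p = real (length p)" for p
    by (induction p) auto
  then show "path_dist ?T [] (?l k) \<le> ereal (real_of_int \<bar>k\<bar>)"
    using S.min_cost_le_walk_cost[OF p(1), of "\<lambda>_. 1"] p(2) by (simp add: path_dist_def)
  show "ereal (real_of_int \<bar>k\<bar>) \<le> path_dist ?T [] (?l k)"
    using exponent_sum_le_path_dist[OF line_tree_subgraph[OF assms], of "?l k" "[]"]
    by (simp add: exponent_sum_line[OF assms])
qed

lemma ball_line_tree:
  assumes "\<alpha> \<in> A \<rightarrow> free_gens n" "\<sigma> \<in> shift_space A"
  shows "ball_graph (line_tree n \<alpha> \<sigma>) [] r
    = line_tree n \<alpha> \<sigma> \<restriction> line n \<alpha> \<sigma> ` {- int r..int r}"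
proof -
  have "{v \<in> verts (line_tree n \<alpha> \<sigma>). path_dist (line_tree n \<alpha> \<sigma>) [] v \<le> ereal (real r)}
    = line n \<alpha> \<sigma> ` {- int r..int r}" (is "?L = _")
  proof -
    have "?L = line n \<alpha> \<sigma> ` {k. real_of_int \<bar>k\<bar> \<le> real r}"
      using path_dist_line_tree[OF assms] by (auto simp: line_tree_def)
    also have "{k. real_of_int \<bar>k\<bar> \<le> real r} = {- int r..int r}"
      by auto
    finally show ?thesis .
  qed
  then show ?thesis by (simp add: ball_graph_def)
qed

section \<open>Isomorphic balls and common central words\<close>

lemma line_eq_of_agree:
  assumes "\<alpha> \<in> A \<rightarrow> free_gens n" "\<sigma> \<in> shift_space A" "\<tau> \<in> shift_space A"
    and agree: "agree r \<sigma> \<tau>" and k: "\<bar>k\<bar> \<le> int r"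
  shows "line n \<alpha> \<sigma> k = line n \<alpha> \<tau> k"
proof -
  interpret group "free_group n" by (rule group_free_group)
  have gen: "\<alpha> (\<upsilon> k) \<in> carrier (free_group n)" if "\<upsilon> \<in> shift_space A" for k and \<upsilon> :: "int \<Rightarrow> 'a"
    using assms(1) that free_gens_subset[of n] by (auto simp: shift_space_def)
  have "\<bar>k\<bar> \<le> int r \<longrightarrow> line n \<alpha> \<sigma> k = line n \<alpha> \<tau> k"
  proof (induction k rule: int_induct[where k = 0])
    case (step1 i)
    then show ?case
      using agree line_add_1[OF assms(1,2), of i] line_add_1[OF assms(1,3), of i]
      by (auto simp: agree_def)
  next
    case (step2 i)
    show ?case
    proof
      assume i: "\<bar>i - 1\<bar> \<le> int r"
      with step2 have "line n \<alpha> \<sigma> i = line n \<alpha> \<tau> i" by auto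
      moreover have "\<sigma> (i - 1) = \<tau> (i - 1)"
        using agree i step2 by (auto simp: agree_def)
      ultimately show "line n \<alpha> \<sigma> (i - 1) = line n \<alpha> \<tau> (i - 1)"
        using line_add_1[OF assms(1,2), of "i - 1"] line_add_1[OF assms(1,3), of "i - 1"]
          line_in_carrier[OF assms(1,2), of "i - 1"] line_in_carrier[OF assms(1,3), of "i - 1"]
          gen[OF assms(3), of "i - 1"]
        by simp
    qed
  qed simp
  then show ?thesis using k by simp
qed

lemma induce_subgraph_eqI:
  assumes "tail G = tail H" "head G = head H" "arcs (G \<restriction> V) = arcs (H \<restriction> V)"
  shows "G \<restriction> V = H \<restriction> V"
  using assms by (simp add: induce_subgraph_def)

text \<open>
  The two balls are equal as graphs, not merely isomorphic. Their vertices agree by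
  \<open>line_eq_of_agree\<close>. An edge with both ends in the ball joins consecutive vertices of the first
  line; by the exponent sum their positions lie in \<open>{- r..r}\<close>, where the second line passes through
  the same vertices.
\<close>

lemma ball_eq_of_agree:
  assumes "\<alpha> \<in> A \<rightarrow> free_gens n" "\<sigma> \<in> shift_space A" "\<tau> \<in> shift_space A"
    and agree: "agree r \<sigma> \<tau>"
  shows "ball_graph (line_tree n \<alpha> \<sigma>) [] r = ball_graph (line_tree n \<alpha> \<tau>) [] r"
proof -
  have verts: "line n \<alpha> \<sigma> ` {- int r..int r} = line n \<alpha> \<tau> ` {- int r..int r}"
    by (intro image_cong refl line_eq_of_agree[OF assms]) auto
  have arcs: "arcs (line_tree n \<alpha> \<upsilon> \<restriction> line n \<alpha> \<upsilon> ` {- int r..int r})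
      \<subseteq> arcs (line_tree n \<alpha> \<upsilon>')"
    if \<upsilon>: "\<upsilon> \<in> shift_space A" "\<upsilon>' \<in> shift_space A" "agree r \<upsilon> \<upsilon>'" for \<upsilon> \<upsilon>'
  proof
    let ?V = "line n \<alpha> \<upsilon> ` {- int r..int r}" and ?C = "cayley_graph n"
    fix a assume "a \<in> arcs (line_tree n \<alpha> \<upsilon> \<restriction> ?V)"
    then have "a \<in> arcs (line_tree n \<alpha> \<upsilon>)" and a: "tail ?C a \<in> ?V" "head ?C a \<in> ?V"
      unfolding induce_subgraph_arcs by (simp_all only: line_tree_def pre_digraph.simps mem_Collect_eq)
    then obtain k where a_arc: "a \<in> arcs ?C"
      and k: "{tail ?C a, head ?C a} = {line n \<alpha> \<upsilon> (k - 1), line n \<alpha> \<upsilon> k}"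
      unfolding line_tree_def pre_digraph.simps by blast
    have range: "\<bar>j\<bar> \<le> int r" if "line n \<alpha> \<upsilon> j \<in> ?V" for j
    proof -
      from that obtain i where i: "line n \<alpha> \<upsilon> j = line n \<alpha> \<upsilon> i" "i \<in> {- int r..int r}" by blast
      have "j = i"
        using arg_cong[OF i(1), of exponent_sum] unfolding exponent_sum_line[OF assms(1) \<upsilon>(1)] .
      with i(2) show ?thesis by auto
    qed
    have "{line n \<alpha> \<upsilon> (k - 1), line n \<alpha> \<upsilon> k} \<subseteq> ?V"
      using a unfolding k[symmetric] by blast
    then have k_range: "\<bar>k - 1\<bar> \<le> int r" "\<bar>k\<bar> \<le> int r"
      using range by blast+
    have "{tail ?C a, head ?C a} = {line n \<alpha> \<upsilon>' (k - 1), line n \<alpha> \<upsilon>' k}"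
      unfolding k k_range[THEN line_eq_of_agree[OF assms(1) \<upsilon>]] by (rule refl)
    with a_arc show "a \<in> arcs (line_tree n \<alpha> \<upsilon>')"
      unfolding line_tree_def pre_digraph.simps by blast
  qed
  have agree': "agree r \<tau> \<sigma>" using agree by (rule agree_sym)
  have ends: "tail (line_tree n \<alpha> \<sigma>) = tail (line_tree n \<alpha> \<tau>)"
      "head (line_tree n \<alpha> \<sigma>) = head (line_tree n \<alpha> \<tau>)"
    by (simp_all add: line_tree_def)
  have "arcs (line_tree n \<alpha> \<sigma> \<restriction> line n \<alpha> \<tau> ` {- int r..int r})
      = arcs (line_tree n \<alpha> \<tau> \<restriction> line n \<alpha> \<tau> ` {- int r..int r})"
    using arcs[OF assms(2,3) agree] arcs[OF assms(3,2) agree']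
    unfolding verts induce_subgraph_arcs ends by blast
  with ends show ?thesis
    unfolding ball_line_tree[OF assms(1,2)] ball_line_tree[OF assms(1,3)] verts
    by (rule induce_subgraph_eqI)
qed

text \<open>
  An isomorphism \<open>f\<close> of the balls fixes the identity, and the head of an edge is the product of its
  tail and its label. Following the line in both directions from the identity, \<open>f\<close> therefore fixes
  every vertex of the ball, so each of them also lies on the second line, at the same position
  because of the exponent sum. The labels are recovered as the quotients of consecutive vertices.
\<close>

lemma agree_of_pointed_isomorphic:
  assumes "\<alpha> \<in> A \<rightarrow> free_gens n" "\<sigma> \<in> shift_space A" "\<tau> \<in> shift_space A" and inj: "inj_on \<alpha> A"
    and iso: "pointed_isomorphic (ball_graph (line_tree n \<alpha> \<sigma>) [] r) []
      (ball_graph (line_tree n \<alpha> \<tau>) [] r) []"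
  shows "agree r \<sigma> \<tau>"
proof -
  interpret group "free_group n" by (rule group_free_group)
  let ?B = "ball_graph (line_tree n \<alpha> \<sigma>) [] r" and ?B' = "ball_graph (line_tree n \<alpha> \<tau>) [] r"
  have gen: "\<alpha> (\<upsilon> k) \<in> carrier (free_group n)" if "\<upsilon> \<in> shift_space A" for k and \<upsilon> :: "int \<Rightarrow> 'a"
    using assms(1) that free_gens_subset[of n] by (auto simp: shift_space_def)
  obtain f where f: "bij_betw f (verts ?B) (verts ?B')" "f [] = []"
    and labels: "\<And>u v h. u \<in> verts ?B \<Longrightarrow> v \<in> verts ?B \<Longrightarrow>
      labelled_arc ?B u h v \<Longrightarrow> labelled_arc ?B' (f u) h (f v)"
    using iso unfolding pointed_isomorphic_def by blast
  have verts: "verts (ball_graph (line_tree n \<alpha> \<upsilon>) [] r) = line n \<alpha> \<upsilon> ` {- int r..int r}"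
    if "\<upsilon> \<in> shift_space A" for \<upsilon>
    by (simp add: ball_line_tree[OF assms(1) that])
  have f_carrier: "f (line n \<alpha> \<sigma> k) \<in> carrier (free_group n)" if "\<bar>k\<bar> \<le> int r" for k
  proof -
    have "line n \<alpha> \<sigma> k \<in> verts ?B"
      unfolding verts[OF assms(2)] using that by (intro imageI) auto
    then have "f (line n \<alpha> \<sigma> k) \<in> verts ?B'"
      using bij_betw_apply[OF f(1)] by blast
    then show ?thesis
      using line_in_carrier[OF assms(1,3)] verts[OF assms(3)] by auto
  qed
  have step: "f (line n \<alpha> \<sigma> (k + 1)) = f (line n \<alpha> \<sigma> k) \<otimes>\<^bsub>free_group n\<^esub> \<alpha> (\<sigma> k)"
    if "k \<in> {- int r..<int r}" for k
  proof -
    have v: "line n \<alpha> \<sigma> k \<in> verts ?B" "line n \<alpha> \<sigma> (k + 1) \<in> verts ?B"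
      using that verts[OF assms(2)] by auto
    have "labelled_arc ?B (line n \<alpha> \<sigma> k) (\<alpha> (\<sigma> k)) (line n \<alpha> \<sigma> (k + 1))"
      unfolding labelled_arc_def
      by (rule bexI[of _ "(line n \<alpha> \<sigma> k, \<alpha> (\<sigma> k))"])
         (use line_tree_arc[OF assms(1,2), of k] that in \<open>auto simp: ball_line_tree[OF assms(1,2)]\<close>)
    from labels[OF v this] show ?thesis
      unfolding labelled_arc_def ball_line_tree[OF assms(1,3)]
      by (auto simp: line_tree_def cayley_graph_def)
  qed
  have fixed: "\<bar>k\<bar> \<le> int r \<longrightarrow> f (line n \<alpha> \<sigma> k) = line n \<alpha> \<sigma> k" for k
  proof (induction k rule: int_induct[where k = 0])
    case (step1 i)
    then show ?case
      using step[of i] line_add_1[OF assms(1,2), of i] by auto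
  next
    case (step2 i)
    show ?case
    proof
      assume i: "\<bar>i - 1\<bar> \<le> int r"
      with step2 have "f (line n \<alpha> \<sigma> i) = line n \<alpha> \<sigma> i" by auto
      then have "f (line n \<alpha> \<sigma> (i - 1)) \<otimes>\<^bsub>free_group n\<^esub> \<alpha> (\<sigma> (i - 1))
        = line n \<alpha> \<sigma> (i - 1) \<otimes>\<^bsub>free_group n\<^esub> \<alpha> (\<sigma> (i - 1))"
        using step[of "i - 1"] line_add_1[OF assms(1,2), of "i - 1"] i step2 by auto
      then show "f (line n \<alpha> \<sigma> (i - 1)) = line n \<alpha> \<sigma> (i - 1)"
        using f_carrier[OF i] line_in_carrier[OF assms(1,2), of "i - 1"] gen[OF assms(2), of "i - 1"]
        by simp
    qed
  qed (simp add: f)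
  have eq: "line n \<alpha> \<sigma> k = line n \<alpha> \<tau> k" if k: "\<bar>k\<bar> \<le> int r" for k
  proof -
    have "line n \<alpha> \<sigma> k \<in> verts ?B"
      unfolding verts[OF assms(2)] using k by (intro imageI) auto
    then have "f (line n \<alpha> \<sigma> k) \<in> verts ?B'"
      using bij_betw_apply[OF f(1)] by blast
    then obtain j where j: "line n \<alpha> \<sigma> k = line n \<alpha> \<tau> j"
      using fixed[of k] k verts[OF assms(3)] by auto
    then have "k = j"
      using exponent_sum_line[OF assms(1,2), of k] exponent_sum_line[OF assms(1,3), of j] by simp
    with j show ?thesis by simp
  qed
  show ?thesis
    unfolding agree_def
  proof
    fix i assume i: "i \<in> {- int r..<int r}"
    have "line n \<alpha> \<tau> i \<otimes>\<^bsub>free_group n\<^esub> \<alpha> (\<sigma> i) = line n \<alpha> \<tau> i \<otimes>\<^bsub>free_group n\<^esub> \<alpha> (\<tau> i)"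
      using eq[of i] eq[of "i + 1"] i line_add_1[OF assms(1,2), of i] line_add_1[OF assms(1,3), of i]
      by auto
    then have "\<alpha> (\<sigma> i) = \<alpha> (\<tau> i)"
      using line_in_carrier[OF assms(1,3), of i] gen[OF assms(2)] gen[OF assms(3)] by simp
    then show "\<sigma> i = \<tau> i"
      using inj_onD[OF inj, of "\<sigma> i" "\<tau> i"] assms(2,3) by (auto simp: shift_space_def)
  qed
qed

lemma pointed_isomorphic_balls_iff:
  assumes "\<alpha> \<in> A \<rightarrow> free_gens n" "\<sigma> \<in> shift_space A" "\<tau> \<in> shift_space A" "inj_on \<alpha> A"
  shows "pointed_isomorphic (ball_graph (line_tree n \<alpha> \<sigma>) [] r) []
      (ball_graph (line_tree n \<alpha> \<tau>) [] r) [] \<longleftrightarrow> agree r \<sigma> \<tau>"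
proof
  assume "agree r \<sigma> \<tau>"
  then show "pointed_isomorphic (ball_graph (line_tree n \<alpha> \<sigma>) [] r) []
      (ball_graph (line_tree n \<alpha> \<tau>) [] r) []"
    unfolding pointed_isomorphic_def
    by (intro exI[of _ id]) (simp add: ball_eq_of_agree[OF assms(1-3)])
qed (rule agree_of_pointed_isomorphic[OF assms])

text \<open>
  Nonzero distances are of the form \<open>exp (- R)\<close> with an integer \<open>R\<close>, which is why \<open>- ln \<delta>\<close> may be
  rounded up. For \<open>\<delta> \<ge> 1\<close> the window is empty, in accordance with all distances being at most 1.
\<close>

lemma ball_metric_line_tree_le_iff:
  assumes "\<alpha> \<in> A \<rightarrow> free_gens n" "\<sigma> \<in> shift_space A" "\<tau> \<in> shift_space A" "inj_on \<alpha> A"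
    and \<delta>: "\<delta> > 0"
  shows "ball_metric n (line_tree n \<alpha> \<sigma>) (line_tree n \<alpha> \<tau>) \<le> \<delta> \<longleftrightarrow> agree (nat \<lceil>- ln \<delta>\<rceil>) \<sigma> \<tau>"
proof (cases "\<sigma> = \<tau>")
  case True
  then show ?thesis using \<delta> by (simp add: ball_metric_def agree_def)
next
  case False
  let ?R = "ball_radius n (line_tree n \<alpha> \<sigma>) (line_tree n \<alpha> \<tau>)"
  have neq: "line_tree n \<alpha> \<sigma> \<noteq> line_tree n \<alpha> \<tau>"
  proof
    assume eq: "line_tree n \<alpha> \<sigma> = line_tree n \<alpha> \<tau>"
    have "agree r \<sigma> \<tau>" for r
      using pointed_isomorphic_balls_iff[OF assms(1,2,2,4), of r]
        pointed_isomorphic_balls_iff[OF assms(1-4), of r] eq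
      by (simp add: agree_def)
    with False show False using agree_all_imp_eq by blast
  qed
  \<comment> \<open>Agreement passes to smaller windows and fails for large ones, so the maximum exists and
    describes exactly the windows of agreement.\<close>
  have R: "?R = (GREATEST r. agree r \<sigma> \<tau>)"
    unfolding ball_radius_def using pointed_isomorphic_balls_iff[OF assms(1-4)]
    by (simp add: free_group_def)
  obtain b where b: "\<not> agree b \<sigma> \<tau>"
    using False agree_all_imp_eq by blast
  have bound: "r \<le> b" if "agree r \<sigma> \<tau>" for r
    using b agree_mono[OF that, of b] by linarith
  have "agree r \<sigma> \<tau> \<longleftrightarrow> r \<le> ?R" for r
  proof
    show "agree r \<sigma> \<tau> \<Longrightarrow> r \<le> ?R"
      unfolding R using Greatest_le_nat[of "\<lambda>r. agree r \<sigma> \<tau>" r b] bound by blast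
    have "agree 0 \<sigma> \<tau>" by (simp add: agree_def)
    then have "agree ?R \<sigma> \<tau>"
      unfolding R using GreatestI_nat[of "\<lambda>r. agree r \<sigma> \<tau>" 0 b] bound by blast
    then show "r \<le> ?R \<Longrightarrow> agree r \<sigma> \<tau>" by (rule agree_mono)
  qed
  moreover have "exp (- real ?R) \<le> \<delta> \<longleftrightarrow> nat \<lceil>- ln \<delta>\<rceil> \<le> ?R"
  proof -
    have "exp (- real ?R) \<le> \<delta> \<longleftrightarrow> - ln \<delta> \<le> real ?R"
      using ln_ge_iff[OF \<delta>, of "- real ?R"] by linarith
    also have "\<dots> \<longleftrightarrow> nat \<lceil>- ln \<delta>\<rceil> \<le> ?R" by linarith
    finally show ?thesis .
  qed
  ultimately show ?thesis using neq by (simp add: ball_metric_def)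
qed

text \<open>
  The constant 1 suffices for the exponent \<open>1 / 2\<close>, since \<open>ln 2 / 2 \<le> 1\<close>. The exponent
  \<open>1 / ln 2\<close>, at which the two metrics are comparable, is greater than 1 and so excluded.
\<close>

lemma hoelder_line_tree:
  assumes "\<alpha> \<in> A \<rightarrow> free_gens n" "inj_on \<alpha> A"
  shows "hoelder_continuous_on (shift_space A) shift_metric (ball_metric n) (line_tree n \<alpha>)"
proof -
  have "ball_metric n (line_tree n \<alpha> \<sigma>) (line_tree n \<alpha> \<tau>) \<le> shift_metric \<sigma> \<tau> powr (1 / 2)"
    if \<sigma>: "\<sigma> \<in> shift_space A" and \<tau>: "\<tau> \<in> shift_space A" for \<sigma> \<tau>
  proof (cases "\<sigma> = \<tau>")
    case False
    define k where "k = (GREATEST m :: int. \<forall>i. \<bar>i\<bar> \<le> m \<longrightarrow> \<sigma> i = \<tau> i)"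
    obtain j where j: "\<sigma> j \<noteq> \<tau> j" using False by blast
    have k: "\<forall>i. \<bar>i\<bar> \<le> k \<longrightarrow> \<sigma> i = \<tau> i"
    proof -
      \<comment> \<open>The maximum over the integers is at least \<open>- 1\<close>, attained vacuously; shifting by 1 turns it
        into a maximum over the natural numbers.\<close>
      define P where "P q \<longleftrightarrow> (\<forall>i. \<bar>i\<bar> \<le> int q - 1 \<longrightarrow> \<sigma> i = \<tau> i)" for q
      define m where "m = (GREATEST q. P q)"
      have P_bound: "q \<le> nat \<bar>j\<bar>" if "P q" for q
        using that[unfolded P_def, rule_format, of j] j by (cases "\<bar>j\<bar> \<le> int q - 1") auto
      have "P 0"
      proof -
        have "\<not> \<bar>i\<bar> \<le> int 0 - 1" for i :: int by simp
        then show ?thesis unfolding P_def by blast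
      qed
      then have "P m"
        unfolding m_def using GreatestI_nat[of P 0 "nat \<bar>j\<bar>"] P_bound by blast
      then have m: "\<forall>i. \<bar>i\<bar> \<le> int m - 1 \<longrightarrow> \<sigma> i = \<tau> i"
        by (simp add: P_def)
      have m_max: "q \<le> m" if "P q" for q
        unfolding m_def using Greatest_le_nat[of P q "nat \<bar>j\<bar>"] P_bound that by blast
      have "k = int m - 1"
        unfolding k_def
      proof (rule Greatest_equality)
        fix q assume q: "\<forall>i. \<bar>i\<bar> \<le> q \<longrightarrow> \<sigma> i = \<tau> i"
        show "q \<le> int m - 1"
          using m_max[of "nat (q + 1)"] q by (cases "q \<ge> 0") (auto simp: P_def)
      qed (use m in auto)
      with m show ?thesis by simp
    qed
    have "ball_metric n (line_tree n \<alpha> \<sigma>) (line_tree n \<alpha> \<tau>) \<le> exp (- real (nat k))"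
      using k by (subst ball_metric_line_tree_le_iff[OF assms(1) \<sigma> \<tau> assms(2)]) (auto simp: agree_def)
    also have "\<dots> \<le> exp (- (of_int k * ln 2 / 2))"
    proof -
      have "of_int k * (ln 2 / 2) \<le> real (nat k) * (ln 2 / 2)"
        by (intro mult_right_mono) auto
      also have "\<dots> \<le> real (nat k) * 1"
        using ln_le_minus_one[of "2 :: real"] by (intro mult_left_mono) auto
      finally show ?thesis by simp
    qed
    also have "\<dots> = (2 powi (- k)) powr (1 / 2)"
    proof -
      have "2 powi (- k) = (2 :: real) powr of_int (- k)"
        by (rule powr_real_of_int'[symmetric]) simp_all
      then have "(2 powi (- k)) powr (1 / 2) = (2 :: real) powr (of_int (- k) * (1 / 2))"
        by (simp only: powr_powr)
      also have "\<dots> = exp (- (of_int k * ln 2 / 2))"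
        by (simp add: powr_def)
      finally show ?thesis by simp
    qed
    finally show ?thesis
      using False by (simp add: shift_metric_def k_def)
  qed (simp add: ball_metric_def)
  then show ?thesis
    unfolding hoelder_continuous_on_def by (intro exI[of _ 1] exI[of _ "1 / 2"]) auto
qed

section \<open>Dimensions of images of the shift space\<close>

lemma set_diam_bounds:
  assumes "diam_le d \<delta> U" "0 \<le> \<delta>" "\<And>x y. 0 \<le> d x y"
  shows "0 \<le> set_diam d U" and "set_diam d U \<le> \<delta>"
proof -
  have "0 \<le> set_diam d U \<and> set_diam d U \<le> \<delta>"
  proof (cases "U = {}")
    case False
    then obtain u where u: "u \<in> U" by blast
    have le: "(case p of (x, y) \<Rightarrow> d x y) \<le> \<delta>" if "p \<in> U \<times> U" for p
      using that assms(1) by (auto simp: diam_le_def)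
    then have bdd: "bdd_above ((\<lambda>(x, y). d x y) ` (U \<times> U))"
      by (intro bdd_aboveI2)
    have "0 \<le> d u u" by (rule assms)
    also have "d u u \<le> (SUP (x, y)\<in>U \<times> U. d x y)"
      using cSUP_upper[OF _ bdd, of "(u, u)"] u by simp
    finally show ?thesis
      using False le by (auto simp: set_diam_def intro!: cSUP_least)
  qed (simp add: set_diam_def assms)
  then show "0 \<le> set_diam d U" "set_diam d U \<le> \<delta>" by auto
qed

lemma diam_le_set_diam:
  assumes "diam_le d \<delta> U"
  shows "diam_le d (set_diam d U) U"
  unfolding diam_le_def
proof (intro ballI)
  fix x y assume xy: "x \<in> U" "y \<in> U"
  have "bdd_above ((\<lambda>(x, y). d x y) ` (U \<times> U))"
    using assms by (intro bdd_aboveI2[where M = \<delta>]) (auto simp: diam_le_def)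
  from cSUP_upper[OF _ this, of "(x, y)"] show "d x y \<le> set_diam d U"
    using xy by (auto simp: set_diam_def)
qed

lemma nat_ceiling_ratio_tendsto: "((\<lambda>x. real (nat \<lceil>x\<rceil>) / x) \<longlongrightarrow> 1) at_top"
proof (rule tendsto_sandwich)
  show "\<forall>\<^sub>F x in at_top. 1 \<le> real (nat \<lceil>x\<rceil>) / x"
    using eventually_gt_at_top[of "0 :: real"] by eventually_elim (simp add: field_simps real_nat_ceiling_ge)
  show "\<forall>\<^sub>F x in at_top. real (nat \<lceil>x\<rceil>) / x \<le> 1 + inverse x"
    using eventually_gt_at_top[of "0 :: real"]
  proof eventually_elim
    case (elim x)
    then have "real (nat \<lceil>x\<rceil>) \<le> x + 1" by linarith
    with elim show ?case by (simp add: field_simps)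
  qed
  show "((\<lambda>x :: real. 1 + inverse x) \<longlongrightarrow> 1) at_top"
    using tendsto_add[OF tendsto_const tendsto_inverse_0_at_top[OF filterlim_ident], of "1 :: real"]
    by simp
qed auto

text \<open>
  Only the last assumption ties the metric to the symbolic structure. It concerns the points of the
  image alone; a covering set may contain other points of \<open>M\<close>, which can only enlarge its diameter.
\<close>

locale cylinder_metric =
  fixes A :: "'a set" and M :: "'x set" and d :: "'x \<Rightarrow> 'x \<Rightarrow> real" and F :: "(int \<Rightarrow> 'a) \<Rightarrow> 'x"
  assumes finite_A: "finite A" and card_A: "card A \<ge> 2"
    and F_in: "F \<in> shift_space A \<rightarrow> M"
    and d_nonneg: "\<And>x y. 0 \<le> d x y" and d_le_1: "\<And>x y. d x y \<le> 1"
    and d_le_iff: "\<And>\<sigma> \<tau> \<delta>. \<sigma> \<in> shift_space A \<Longrightarrow> \<tau> \<in> shift_space A \<Longrightarrow> \<delta> > 0 \<Longrightarrow>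
      d (F \<sigma>) (F \<tau>) \<le> \<delta> \<longleftrightarrow> agree (nat \<lceil>- ln \<delta>\<rceil>) \<sigma> \<tau>"
begin

definition words :: "nat \<Rightarrow> (int \<Rightarrow> 'a) set" where
  "words r = {- int r..<int r} \<rightarrow>\<^sub>E A"

definition cylinder :: "nat \<Rightarrow> (int \<Rightarrow> 'a) \<Rightarrow> (int \<Rightarrow> 'a) set" where
  "cylinder r w = {\<sigma> \<in> shift_space A. agree r \<sigma> w}"

lemma finite_words: "finite (words r)"
  by (simp add: words_def finite_PiE finite_A)

lemma card_words: "card (words r) = card A ^ (2 * r)"
  by (simp add: words_def card_PiE nat_mult_distrib)

lemma shift_space_cylinders: "shift_space A = (\<Union>w\<in>words r. cylinder r w)"
proof -
  have "\<sigma> \<in> cylinder r (restrict \<sigma> {- int r..<int r})" "restrict \<sigma> {- int r..<int r} \<in> words r"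
    if "\<sigma> \<in> shift_space A" for \<sigma>
    using that by (auto simp: cylinder_def words_def agree_def shift_space_def)
  then show ?thesis by (auto simp: cylinder_def)
qed

lemma cylinder_nonempty:
  assumes "w \<in> words r"
  obtains \<sigma> where "\<sigma> \<in> cylinder r w"
proof -
  obtain a where "a \<in> A" using card_A by fastforce
  then have "(\<lambda>i. if i \<in> {- int r..<int r} then w i else a) \<in> cylinder r w"
    using assms by (auto simp: cylinder_def words_def agree_def shift_space_def PiE_iff)
  then show thesis by (rule that)
qed

lemma words_eqI:
  assumes "v \<in> words r" "w \<in> words r" "agree r v w"
  shows "v = w"
  using PiE_ext[OF assms(1,2)[unfolded words_def]] assms(3) by (simp add: agree_def)

lemma diam_le_cylinder:
  assumes "\<delta> > 0"
  shows "diam_le d \<delta> (F ` cylinder (nat \<lceil>- ln \<delta>\<rceil>) w)"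
  unfolding diam_le_def
proof (clarify, unfold cylinder_def mem_Collect_eq, elim conjE)
  fix \<sigma> \<tau> assume "\<sigma> \<in> shift_space A" "agree (nat \<lceil>- ln \<delta>\<rceil>) \<sigma> w"
    and "\<tau> \<in> shift_space A" "agree (nat \<lceil>- ln \<delta>\<rceil>) \<tau> w"
  then show "d (F \<sigma>) (F \<tau>) \<le> \<delta>"
    using d_le_iff[OF _ _ assms] agree_trans agree_sym by blast
qed

lemma agree_of_diam_le:
  assumes "diam_le d \<delta> U" "\<delta> > 0" "F \<sigma> \<in> U" "F \<tau> \<in> U" "\<sigma> \<in> shift_space A" "\<tau> \<in> shift_space A"
  shows "agree (nat \<lceil>- ln \<delta>\<rceil>) \<sigma> \<tau>"
  using assms d_le_iff[of \<sigma> \<tau> \<delta>] by (auto simp: diam_le_def)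

text \<open>
  The cylinders form a cover. Conversely, a set of diameter at most \<open>\<delta>\<close> meets the image of only
  one of them, so in any cover different words need different sets.
\<close>

lemma covering_number_eq:
  assumes \<delta>: "\<delta> > 0"
  shows "covering_number M d \<delta> (F ` shift_space A) = enat (card A ^ (2 * nat \<lceil>- ln \<delta>\<rceil>))"
proof (rule antisym)
  let ?r = "nat \<lceil>- ln \<delta>\<rceil>"
  let ?U = "(\<lambda>w. F ` cylinder ?r w) ` words ?r"
  have "covering_number M d \<delta> (F ` shift_space A) \<le> enat (card ?U)"
    unfolding covering_number_def
  proof (rule INF_lower, safe)
    show "finite ?U" by (intro finite_imageI finite_words)
    show "F \<sigma> \<in> \<Union> ?U" if "\<sigma> \<in> shift_space A" for \<sigma>
      using that unfolding shift_space_cylinders[of ?r] by blast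
    show "F \<sigma> \<in> M" if "\<sigma> \<in> cylinder ?r w" for \<sigma> w
      using that F_in by (auto simp: cylinder_def)
  qed (rule diam_le_cylinder[OF \<delta>])
  also have "\<dots> \<le> enat (card A ^ (2 * ?r))"
    using card_image_le[OF finite_words, of "\<lambda>w. F ` cylinder ?r w" ?r] by (simp add: card_words)
  finally show "covering_number M d \<delta> (F ` shift_space A) \<le> enat (card A ^ (2 * ?r))" .
next
  let ?r = "nat \<lceil>- ln \<delta>\<rceil>"
  show "enat (card A ^ (2 * ?r)) \<le> covering_number M d \<delta> (F ` shift_space A)"
    unfolding covering_number_def
  proof (rule INF_greatest)
    fix \<U> assume "\<U> \<in> {\<U>. finite \<U> \<and> (\<forall>U\<in>\<U>. U \<subseteq> M \<and> diam_le d \<delta> U) \<and> F ` shift_space A \<subseteq> \<Union> \<U>}"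
    then have fin: "finite \<U>" and diam: "\<And>U. U \<in> \<U> \<Longrightarrow> diam_le d \<delta> U"
      and cover: "F ` shift_space A \<subseteq> \<Union> \<U>" by auto
    have "\<exists>U\<in>\<U>. \<exists>\<sigma>\<in>cylinder ?r w. F \<sigma> \<in> U" if w: "w \<in> words ?r" for w
    proof -
      obtain \<sigma> where "\<sigma> \<in> cylinder ?r w" using cylinder_nonempty[OF w] by blast
      moreover from this have "F \<sigma> \<in> \<Union> \<U>" using cover by (auto simp: cylinder_def)
      ultimately show ?thesis by blast
    qed
    then obtain u where u: "\<And>w. w \<in> words ?r \<Longrightarrow> u w \<in> \<U>"
      "\<And>w. w \<in> words ?r \<Longrightarrow> \<exists>\<sigma>\<in>cylinder ?r w. F \<sigma> \<in> u w" by metis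
    have "inj_on u (words ?r)"
    proof (rule inj_onI)
      fix v w assume v: "v \<in> words ?r" and w: "w \<in> words ?r" and eq: "u v = u w"
      obtain \<sigma> \<tau> where \<sigma>: "\<sigma> \<in> cylinder ?r v" "F \<sigma> \<in> u v" and \<tau>: "\<tau> \<in> cylinder ?r w" "F \<tau> \<in> u w"
        using u(2)[OF v] u(2)[OF w] by blast
      have "agree ?r \<sigma> \<tau>"
        using agree_of_diam_le[OF diam[OF u(1)[OF v]] \<delta>, of \<sigma> \<tau>] \<sigma> \<tau> eq by (auto simp: cylinder_def)
      then have "agree ?r v w"
        using \<sigma>(1) \<tau>(1) unfolding cylinder_def by (blast intro: agree_sym agree_trans)
      with v w show "v = w" by (rule words_eqI)
    qed
    then have "card (words ?r) \<le> card \<U>"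
      using u(1) fin by (intro card_inj_on_le[of u]) auto
    then show "enat (card A ^ (2 * ?r)) \<le> enat (card \<U>)"
      by (simp add: card_words)
  qed
qed

lemma box_ratio_tendsto:
  "(box_ratio M d (F ` shift_space A) \<longlongrightarrow> ereal (2 * ln (card A))) (at_right 0)"
proof -
  have "filterlim (\<lambda>\<delta> :: real. - ln \<delta>) at_top (at_right 0)"
    using ln_at_0 unfolding filterlim_uminus_at_bot .
  from tendsto_ereal[OF tendsto_mult_left[OF filterlim_compose[OF nat_ceiling_ratio_tendsto this], of "2 * ln (card A)"]]
  have "((\<lambda>\<delta>. ereal ((2 * ln (card A)) * (real (nat \<lceil>- ln \<delta>\<rceil>) / (- ln \<delta>)))) \<longlongrightarrow> ereal (2 * ln (card A)))
      (at_right 0)"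
    unfolding mult_1_right .
  moreover have "\<forall>\<^sub>F \<delta> in at_right 0. ereal ((2 * ln (card A)) * (real (nat \<lceil>- ln \<delta>\<rceil>) / (- ln \<delta>)))
      = box_ratio M d (F ` shift_space A) \<delta>"
  proof (rule eventually_mono[OF eventually_at_right_less])
    fix \<delta> :: real assume elim: "0 < \<delta>"
    define r where "r = nat \<lceil>- ln \<delta>\<rceil>"
    have "ln (real (card A ^ (2 * r))) = 2 * ln (card A) * real r"
      using card_A by (simp add: ln_realpow)
    moreover have "box_ratio M d (F ` shift_space A) \<delta> = ereal (ln (real (card A ^ (2 * r))) / (- ln \<delta>))"
      unfolding box_ratio_def covering_number_eq[OF elim] r_def[symmetric] by simp
    ultimately show "ereal ((2 * ln (card A)) * (real (nat \<lceil>- ln \<delta>\<rceil>) / (- ln \<delta>)))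
        = box_ratio M d (F ` shift_space A) \<delta>"
      unfolding r_def[symmetric] by (simp only: times_divide_eq_right)
  qed
  ultimately show ?thesis by (rule Lim_transform_eventually)
qed

lemma box_dim_eq:
  "lower_box_dim M d (F ` shift_space A) = ereal (2 * ln (card A))"
  "upper_box_dim M d (F ` shift_space A) = ereal (2 * ln (card A))"
  using lim_imp_Liminf[OF _ box_ratio_tendsto] lim_imp_Limsup[OF _ box_ratio_tendsto]
  by (simp_all add: lower_box_dim_def upper_box_dim_def)

lemma exp_2_ln_card: "exp (2 * ln (real (card A))) = real (card A) ^ 2"
  using card_A by (simp add: exp_double)

text \<open>
  The cylinders of level \<open>r\<close> contribute at most \<open>card A ^ (2 * r) * exp (- r * s)\<close>, which is the
  \<open>r\<close>-th power of a number below 1.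
\<close>

lemma hausdorff_measure_eq_0:
  assumes s: "s > 2 * ln (card A)"
  shows "hausdorff_measure M d s (F ` shift_space A) = 0"
proof -
  define q where "q = real (card A) ^ 2 * exp (- s)"
  have ln_A: "ln (card A) > 0" using card_A by simp
  have q: "0 \<le> q" "q < 1"
    using s by (simp_all add: q_def flip: exp_2_ln_card exp_add)
  have le: "hausdorff_premeasure M d s \<delta> (F ` shift_space A) \<le> ennreal (q ^ r)"
    if "\<delta> > 0" and r: "r \<ge> nat \<lceil>- ln \<delta>\<rceil>" for \<delta> r
  proof -
    obtain w where w: "bij_betw w {0..<card (words r)} (words r)"
      using ex_bij_betw_nat_finite[OF finite_words] by blast
    define U where "U i = (if i < card (words r) then F ` cylinder r (w i) else {})" for i
    have exp_le: "exp (- real r) \<le> \<delta>"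
    proof -
      have "- real r \<le> ln \<delta>" using r by linarith
      then show ?thesis using \<open>\<delta> > 0\<close> by (simp add: ln_ge_iff)
    qed
    have diam: "diam_le d (exp (- real r)) (U i)" for i
      using diam_le_cylinder[of "exp (- real r)" "w i"] by (auto simp: U_def diam_le_def)
    have "hausdorff_premeasure M d s \<delta> (F ` shift_space A) \<le> (\<Sum>i. ennreal (set_diam d (U i) powr s))"
      unfolding hausdorff_premeasure_def
    proof (rule INF_lower, safe)
      show "diam_le d \<delta> (U i)" for i
        using diam[of i] exp_le by (fastforce simp: diam_le_def)
      show "x \<in> M" if "x \<in> U i" for x i
        using that F_in by (auto simp: U_def cylinder_def split: if_splits)
      show "F \<sigma> \<in> (\<Union>i. U i)" if \<sigma>: "\<sigma> \<in> shift_space A" for \<sigma>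
      proof -
        obtain v where v: "v \<in> words r" "\<sigma> \<in> cylinder r v"
          using \<sigma> unfolding shift_space_cylinders[of r] by blast
        from v(1) have "v \<in> w ` {0..<card (words r)}"
          by (simp only: bij_betw_imp_surj_on[OF w])
        then obtain i where "i < card (words r)" "w i = v" by auto
        with v(2) show ?thesis by (auto simp: U_def)
      qed
    qed
    also have "\<dots> = (\<Sum>i<card (words r). ennreal (set_diam d (U i) powr s))"
      by (rule suminf_finite) (auto simp: U_def set_diam_def)
    also have "\<dots> \<le> (\<Sum>i<card (words r). ennreal (exp (- s) ^ r))"
    proof (intro sum_mono ennreal_leI)
      fix i
      have "set_diam d (U i) powr s \<le> exp (- real r) powr s"
        using set_diam_bounds[OF diam _ d_nonneg] s ln_A by (intro powr_mono2) auto
      also have "\<dots> = exp (- s) ^ r"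
        by (simp add: powr_def mult.commute flip: exp_of_nat_mult)
      finally show "set_diam d (U i) powr s \<le> exp (- s) ^ r" .
    qed
    also have "\<dots> = ennreal (real (card (words r)) * exp (- s) ^ r)"
      by (simp add: ennreal_of_nat_eq_real_of_nat ennreal_mult)
    also have "real (card (words r)) * exp (- s) ^ r = q ^ r"
      by (simp add: card_words q_def power_mult power_mult_distrib)
    finally show ?thesis .
  qed
  have "hausdorff_premeasure M d s \<delta> (F ` shift_space A) \<le> 0" if \<delta>: "\<delta> > 0" for \<delta>
  proof (rule tendsto_lowerbound)
    show "(\<lambda>r. ennreal (q ^ r)) \<longlonglongrightarrow> 0"
      using q by (simp flip: ennreal_0 add: LIMSEQ_power_zero)
    show "\<forall>\<^sub>F r in sequentially. hausdorff_premeasure M d s \<delta> (F ` shift_space A) \<le> ennreal (q ^ r)"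
      using eventually_ge_at_top[of "nat \<lceil>- ln \<delta>\<rceil>"] by eventually_elim (rule le[OF \<delta>])
  qed simp
  then have "hausdorff_measure M d s (F ` shift_space A) \<le> 0"
    unfolding hausdorff_measure_def by (intro SUP_least) simp
  then show ?thesis by simp
qed

text \<open>The mass distribution: the letters are independent and uniformly distributed.\<close>

abbreviation bernoulli :: "(int \<Rightarrow> 'a) measure" where
  "bernoulli \<equiv> Pi\<^sub>M UNIV (\<lambda>_. uniform_count_measure A)"

lemma product_prob_space_bernoulli: "product_prob_space (\<lambda>_ :: int. uniform_count_measure A)"
proof -
  have "A \<noteq> {}" using card_A by auto
  then have "prob_space (uniform_count_measure A)"
    using finite_A by (intro prob_space_uniform_count_measure)
  then show ?thesis
    by (intro product_prob_spaceI)
qed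

lemma space_bernoulli: "space bernoulli = shift_space A"
  by (auto simp: space_PiM space_uniform_count_measure shift_space_def PiE_UNIV_domain)

lemma
  assumes "\<sigma> \<in> shift_space A"
  shows cylinder_in_sets: "cylinder r \<sigma> \<in> sets bernoulli"
    and emeasure_cylinder: "emeasure bernoulli (cylinder r \<sigma>) = ennreal (1 / real (card A) ^ (2 * r))"
proof -
  interpret product_prob_space "\<lambda>_ :: int. uniform_count_measure A" UNIV
    by (rule product_prob_space_bernoulli)
  have \<sigma>: "\<sigma> i \<in> A" for i using assms by (auto simp: shift_space_def)
  have eq: "cylinder r \<sigma> = {x \<in> space bernoulli. \<forall>i\<in>{- int r..<int r}. x i \<in> {\<sigma> i}}"
    by (auto simp: cylinder_def agree_def space_bernoulli)
  show "cylinder r \<sigma> \<in> sets bernoulli"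
    unfolding eq using \<sigma> by (intro sets.sets_Collect_finite_All sets_Collect_single')
      (auto simp: sets_uniform_count_measure)
  show "emeasure bernoulli (cylinder r \<sigma>) = ennreal (1 / real (card A) ^ (2 * r))"
    unfolding eq using \<sigma> finite_A
    by (subst emeasure_PiM_Collect)
       (auto simp: sets_uniform_count_measure emeasure_uniform_count_measure prod_ennreal
         power_divide nat_mult_distrib ennreal_power)
qed

lemma
  assumes "\<sigma> \<in> shift_space A"
  shows singleton_in_sets: "{\<sigma>} \<in> sets bernoulli"
    and emeasure_singleton: "emeasure bernoulli {\<sigma>} = 0"
proof -
  have sub: "{\<sigma>} \<subseteq> cylinder r \<sigma>" for r
    using assms by (auto simp: cylinder_def agree_def)
  have "{\<sigma>} = (\<Inter>r. cylinder r \<sigma>)"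
    using sub agree_all_imp_eq by (fastforce simp: cylinder_def)
  then show "{\<sigma>} \<in> sets bernoulli"
    using cylinder_in_sets[OF assms] by auto
  have "emeasure bernoulli {\<sigma>} \<le> 0"
  proof (rule tendsto_lowerbound)
    have "1 < real (card A) ^ 2"
      using card_A by (intro one_less_power) auto
    then have "(\<lambda>r. (1 / real (card A) ^ 2) ^ r) \<longlonglongrightarrow> 0"
      by (intro LIMSEQ_power_zero) (simp add: divide_less_eq)
    then show "(\<lambda>r. ennreal (1 / real (card A) ^ (2 * r))) \<longlonglongrightarrow> 0"
      by (simp add: power_mult power_divide flip: ennreal_0)
    show "\<forall>\<^sub>F r in sequentially. emeasure bernoulli {\<sigma>} \<le> ennreal (1 / real (card A) ^ (2 * r))"
      using emeasure_mono[OF sub cylinder_in_sets[OF assms]] by (simp add: emeasure_cylinder[OF assms])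
  qed simp
  then show "emeasure bernoulli {\<sigma>} = 0" by simp
qed

text \<open>
  The mass distribution estimate. The preimage of \<open>U\<close> itself need not be measurable, so it is
  replaced by a measurable superset: a single point if \<open>U\<close> has diameter 0, and otherwise the
  cylinder whose level is given by the diameter \<open>D\<close> of \<open>U\<close>. Its mass is at most \<open>D\<close> to the power
  \<open>2 * ln (card A)\<close>, hence at most \<open>D powr s\<close> because \<open>D \<le> 1\<close>.
\<close>

lemma mass_le_diam_powr:
  assumes s: "0 < s" "s \<le> 2 * ln (card A)"
  obtains C where "C \<in> sets bernoulli" "{\<sigma> \<in> shift_space A. F \<sigma> \<in> U} \<subseteq> C"
    "emeasure bernoulli C \<le> ennreal (set_diam d U powr s)"
proof (cases "\<exists>\<sigma>\<in>shift_space A. F \<sigma> \<in> U")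
  case False
  then have "{\<sigma> \<in> shift_space A. F \<sigma> \<in> U} \<subseteq> {}" by auto
  then show thesis by (intro that[of "{}"]) auto
next
  case True
  then obtain \<sigma> where \<sigma>: "\<sigma> \<in> shift_space A" "F \<sigma> \<in> U" by blast
  have diam1: "diam_le d 1 U" by (simp add: diam_le_def d_le_1)
  note diam = diam_le_set_diam[OF diam1]
  have D: "0 \<le> set_diam d U" "set_diam d U \<le> 1"
    using set_diam_bounds[OF diam1 _ d_nonneg] by auto
  show thesis
  proof (cases "set_diam d U = 0")
    case True
    have "\<tau> = \<sigma>" if \<tau>: "\<tau> \<in> shift_space A" "F \<tau> \<in> U" for \<tau>
    proof (rule agree_all_imp_eq)
      fix r
      have "diam_le d (exp (- real r)) U"
        using diam unfolding True diam_le_def by (meson exp_ge_zero order_trans)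
      from agree_of_diam_le[OF this] show "agree r \<tau> \<sigma>" using \<sigma> \<tau> by simp
    qed
    then show thesis
      using singleton_in_sets[OF \<sigma>(1)] emeasure_singleton[OF \<sigma>(1)] by (intro that[of "{\<sigma>}"]) auto
  next
    case False
    with D have pos: "set_diam d U > 0" by simp
    let ?r = "nat \<lceil>- ln (set_diam d U)\<rceil>"
    have "{\<tau> \<in> shift_space A. F \<tau> \<in> U} \<subseteq> cylinder ?r \<sigma>"
      using agree_of_diam_le[OF diam pos] \<sigma> by (auto simp: cylinder_def)
    moreover have "1 / real (card A) ^ (2 * ?r) \<le> set_diam d U powr s"
    proof -
      have "- ln (set_diam d U) * s \<le> real ?r * (2 * ln (card A))"
        by (rule mult_mono[OF real_nat_ceiling_ge]) (use s in simp_all)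
      then have "exp (- (real ?r * (2 * ln (card A)))) \<le> set_diam d U powr s"
        using pos by (simp add: powr_def mult.commute)
      moreover have "exp (real ?r * (2 * ln (card A))) = real (card A) ^ (2 * ?r)"
        by (simp only: exp_of_nat_mult exp_2_ln_card power_mult)
      ultimately show ?thesis
        by (simp only: exp_minus inverse_eq_divide)
    qed
    ultimately show thesis
      using cylinder_in_sets[OF \<sigma>(1)] emeasure_cylinder[OF \<sigma>(1)]
      by (intro that[of "cylinder ?r \<sigma>"]) (auto intro: ennreal_leI)
  qed
qed

text \<open>
  The measurable sets of \<open>mass_le_diam_powr\<close> cover the shift space, which has mass 1. The scale 1
  already suffices, since the Hausdorff measure is a supremum over all scales.
\<close>

lemma hausdorff_measure_ge_1:
  assumes s: "0 < s" "s \<le> 2 * ln (card A)"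
  shows "1 \<le> hausdorff_measure M d s (F ` shift_space A)"
proof -
  interpret product_prob_space "\<lambda>_ :: int. uniform_count_measure A" UNIV
    by (rule product_prob_space_bernoulli)
  have "1 \<le> hausdorff_premeasure M d s 1 (F ` shift_space A)"
    unfolding hausdorff_premeasure_def
  proof (rule INF_greatest)
    fix U :: "nat \<Rightarrow> 'x set"
    assume "U \<in> {U. (\<forall>i. U i \<subseteq> M \<and> diam_le d 1 (U i)) \<and> F ` shift_space A \<subseteq> (\<Union>i. U i)}"
    then have cover: "F ` shift_space A \<subseteq> (\<Union>i. U i)" by simp
    have "\<forall>i. \<exists>C. C \<in> sets bernoulli \<and> {\<sigma> \<in> shift_space A. F \<sigma> \<in> U i} \<subseteq> C \<and>
        emeasure bernoulli C \<le> ennreal (set_diam d (U i) powr s)"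
      by (rule allI, rule mass_le_diam_powr[OF s]) (intro exI conjI)
    then obtain C where "\<forall>i. C i \<in> sets bernoulli \<and> {\<sigma> \<in> shift_space A. F \<sigma> \<in> U i} \<subseteq> C i \<and>
        emeasure bernoulli (C i) \<le> ennreal (set_diam d (U i) powr s)"
      by (rule choice[elim_format]) (erule exE)
    then have C: "C i \<in> sets bernoulli" "{\<sigma> \<in> shift_space A. F \<sigma> \<in> U i} \<subseteq> C i"
        "emeasure bernoulli (C i) \<le> ennreal (set_diam d (U i) powr s)" for i
      by (blast dest: spec)+
    have "1 = emeasure bernoulli (space bernoulli)"
      by (rule P.emeasure_space_1[symmetric])
    also have "\<dots> \<le> emeasure bernoulli (\<Union>i. C i)"
    proof (rule emeasure_mono)
      show "space bernoulli \<subseteq> (\<Union>i. C i)"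
      proof
        fix \<sigma> assume "\<sigma> \<in> space bernoulli"
        then have \<sigma>: "\<sigma> \<in> shift_space A" unfolding space_bernoulli .
        then obtain i where "F \<sigma> \<in> U i" using cover by blast
        with \<sigma> C(2)[of i] show "\<sigma> \<in> (\<Union>i. C i)" by blast
      qed
      show "(\<Union>i. C i) \<in> sets bernoulli"
        using C(1) by (intro sets.countable_UN) blast
    qed
    also have "\<dots> \<le> (\<Sum>i. emeasure bernoulli (C i))"
      using C(1) by (intro emeasure_subadditive_countably) blast
    also have "\<dots> \<le> (\<Sum>i. ennreal (set_diam d (U i) powr s))"
      by (rule suminf_le[OF C(3)]) (rule summableI)+
    finally show "1 \<le> (\<Sum>i. ennreal (set_diam d (U i) powr s))" .
  qed
  also have "\<dots> \<le> hausdorff_measure M d s (F ` shift_space A)"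
    unfolding hausdorff_measure_def by (rule SUP_upper) simp
  finally show ?thesis .
qed

lemma hausdorff_dim_eq: "hausdorff_dim M d (F ` shift_space A) = ereal (2 * ln (card A))"
proof (rule antisym)
  have ln_A: "ln (card A) > 0" using card_A by simp
  show "hausdorff_dim M d (F ` shift_space A) \<le> ereal (2 * ln (card A))"
  proof (rule ereal_le_epsilon2)
    fix e :: real assume "e > 0"
    then have "hausdorff_measure M d (2 * ln (card A) + e) (F ` shift_space A) = 0"
      by (intro hausdorff_measure_eq_0) simp
    with \<open>e > 0\<close> ln_A show "hausdorff_dim M d (F ` shift_space A) \<le> ereal (2 * ln (card A)) + ereal e"
      unfolding hausdorff_dim_def plus_ereal.simps
      by (intro Inf_lower CollectI exI[of _ "2 * ln (card A) + e"]) simp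
  qed
  show "ereal (2 * ln (card A)) \<le> hausdorff_dim M d (F ` shift_space A)"
    unfolding hausdorff_dim_def
  proof (rule Inf_greatest, clarify)
    fix s :: real assume "0 < s" and 0: "hausdorff_measure M d s (F ` shift_space A) = 0"
    then show "ereal (2 * ln (card A)) \<le> ereal s"
      using hausdorff_measure_ge_1[of s] by (cases "s \<le> 2 * ln (card A)") auto
  qed
qed

end

theorem lemma1p2:
  fixes A :: "'a set" and n :: nat and \<alpha> :: "'a \<Rightarrow> fword"
  assumes "finite A" and "card A \<ge> 2"
    and "n \<ge> card A"
    and "\<alpha> \<in> A \<rightarrow> free_gens n" and "inj_on \<alpha> A"
  defines "\<Phi> \<equiv> line_tree n \<alpha>"
  defines "S \<equiv> \<Phi> ` shift_space A"
  shows "hoelder_continuous_on (shift_space A) shift_metric (ball_metric n) \<Phi>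
    \<and> 0 < hausdorff_dim (pointed_trees n) (ball_metric n) S
    \<and> hausdorff_dim (pointed_trees n) (ball_metric n) S
        = lower_box_dim (pointed_trees n) (ball_metric n) S
    \<and> lower_box_dim (pointed_trees n) (ball_metric n) S
        = upper_box_dim (pointed_trees n) (ball_metric n) S
    \<and> upper_box_dim (pointed_trees n) (ball_metric n) S < \<infinity>"
proof -
  interpret cylinder_metric A "pointed_trees n" "ball_metric n" \<Phi>
  proof
    show "\<Phi> \<in> shift_space A \<rightarrow> pointed_trees n"
      using line_tree_in_pointed_trees[OF assms(4)] by (simp add: \<Phi>_def)
    show "ball_metric n (\<Phi> \<sigma>) (\<Phi> \<tau>) \<le> \<delta> \<longleftrightarrow> agree (nat \<lceil>- ln \<delta>\<rceil>) \<sigma> \<tau>"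
      if "\<sigma> \<in> shift_space A" "\<tau> \<in> shift_space A" "\<delta> > 0" for \<sigma> \<tau> \<delta>
      unfolding \<Phi>_def using assms(4) that(1,2) assms(5) that(3) by (rule ball_metric_line_tree_le_iff)
  qed (use assms(1,2) in \<open>auto simp: ball_metric_def\<close>)
  have "ln (card A) > 0" using assms(2) by simp
  then show ?thesis
    using hoelder_line_tree[OF assms(4,5)]
    by (simp add: S_def hausdorff_dim_eq box_dim_eq) (simp add: \<Phi>_def)
qed

end
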